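(* Suppose $\kappa=\kappa_1=\dots=\kappa_f$ and, as $m\to\infty$, $f/m\to\bar f$ and $\kappa/m\to\bar\kappa$ for some $\bar f>0$ and $\bar\kappa\ge0$. Let $\psi=0$ when $\bar\kappa=0$, and when $\bar\kappa>0$ let $\psi$ be the unique solution of $$\psi^2-\psi(1+\bar f+\bar\kappa)+\bar\kappa=0$$ on $(0,\bar\kappa\wedge1)$ (such a unique solution exists). Then, as $m\to\infty$, for every filament $i$, $$\mathbb P[L_i\ge l]\to\Bigl(\frac{1-\psi}{\bar f+1-\psi}\Bigr)^l,\qquad l=0,1,2,\dots,$$ and $m^{-1}M\to\psi$ in probability.
   Context: For each $m\in\mathbb N$ consider $m$ monomers and $f=f(m)\ge1$ filaments with dissociation constants $\kappa_1,\dots,\kappa_f>0$, which may depend on $m$. $(L_1,\dots,L_f)$ is a random vector of nonnegative integers with $$\mathbb P[L_1=l_1,\dots,L_f=l_f]=c_{m,f}^{-1}\,m!\,\frac{\kappa_1^{-l_1}\cdots\kappa_f^{-l_f}}{(m-l_1-\dots-l_f)!},\qquad l_1+\dots+l_f\le m,$$ where $c_{m,f}$ is the normalization constant, and $M=m-L_1-\dots-L_f$. The dependence of all quantities on $m$ is suppressed. $a\wedge b$ denotes the minimum. *)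

theory Defs
  imports "HOL-Probability.Probability"
begin

definition length_vectors :: "nat \<Rightarrow> nat \<Rightarrow> (nat \<Rightarrow> nat) set" where
  "length_vectors m f = {l \<in> {1..f} \<rightarrow>\<^sub>E UNIV. (\<Sum>i=1..f. l i) \<le> m}"

definition length_weight :: "nat \<Rightarrow> nat \<Rightarrow> (nat \<Rightarrow> real) \<Rightarrow> (nat \<Rightarrow> nat) \<Rightarrow> real" where
  "length_weight m f \<kappa> l =
     fact m * (\<Prod>i=1..f. \<kappa> i powi (- int (l i))) / fact (m - (\<Sum>i=1..f. l i))"

definition normalization :: "nat \<Rightarrow> nat \<Rightarrow> (nat \<Rightarrow> real) \<Rightarrow> real" where
  "normalization m f \<kappa> = (\<Sum>l\<in>length_vectors m f. length_weight m f \<kappa> l)"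

text \<open>Filaments are numbered \<open>1, \<dots>, f\<close>; nothing is said about \<open>L i\<close> for other \<open>i\<close>.\<close>

definition filament_lengths ::
    "'a measure \<Rightarrow> nat \<Rightarrow> nat \<Rightarrow> (nat \<Rightarrow> real) \<Rightarrow> (nat \<Rightarrow> 'a \<Rightarrow> nat) \<Rightarrow> bool" where
  "filament_lengths \<Omega> m f \<kappa> L \<longleftrightarrow>
     prob_space \<Omega> \<and>
     (\<forall>i\<in>{1..f}. L i \<in> measurable \<Omega> (count_space UNIV)) \<and>
     (\<forall>l\<in>length_vectors m f.
        measure \<Omega> {\<omega> \<in> space \<Omega>. \<forall>i\<in>{1..f}. L i \<omega> = l i} =
          length_weight m f \<kappa> l / normalization m f \<kappa>)"

text \<open>Real-valued subtraction: the total length is at most \<open>m\<close> only almost surely.\<close>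

definition monomers :: "nat \<Rightarrow> nat \<Rightarrow> (nat \<Rightarrow> 'a \<Rightarrow> nat) \<Rightarrow> 'a \<Rightarrow> real" where
  "monomers m f L \<omega> = real m - (\<Sum>i=1..f. real (L i \<omega>))"

definition limit_root :: "real \<Rightarrow> real \<Rightarrow> real \<Rightarrow> bool" where
  "limit_root fbar kbar x \<longleftrightarrow>
     x \<in> {0<..<min kbar 1} \<and> x\<^sup>2 - x * (1 + fbar + kbar) + kbar = 0"

definition psi :: "real \<Rightarrow> real \<Rightarrow> real" where
  "psi fbar kbar = (if kbar = 0 then 0 else (THE x. limit_root fbar kbar x))"

text \<open>The random variables may live on a different probability space for each index.\<close>

definition tendsto_in_probability ::
    "(nat \<Rightarrow> 'a measure) \<Rightarrow> (nat \<Rightarrow> 'a \<Rightarrow> real) \<Rightarrow> real \<Rightarrow> bool" where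
  "tendsto_in_probability \<Omega> X c \<longleftrightarrow>
     (\<forall>\<epsilon>>0. (\<lambda>m. measure (\<Omega> m) {\<omega> \<in> space (\<Omega> m). \<bar>X m \<omega> - c\<bar> > \<epsilon>}) \<longlonglongrightarrow> 0)"

lemma finite_length_vectors: "finite (length_vectors m f)"
proof (rule finite_subset)
  show "length_vectors m f \<subseteq> {1..f} \<rightarrow>\<^sub>E {..m}"
  proof
    fix l assume l: "l \<in> length_vectors m f"
    have "l i \<le> m" if "i \<in> {1..f}" for i
      using l member_le_sum[of i "{1..f}" l] that
      by (auto simp: length_vectors_def)
    with l show "l \<in> {1..f} \<rightarrow>\<^sub>E {..m}"
      by (auto simp: length_vectors_def PiE_def)
  qed
qed (auto intro: finite_PiE)

lemma normalization_pos:
  assumes "\<And>i. i \<in> {1..f} \<Longrightarrow> \<kappa> i > 0"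
  shows "normalization m f \<kappa> > 0"
proof -
  have "(\<lambda>i\<in>{1..f}. 0) \<in> length_vectors m f"
    by (auto simp: length_vectors_def)
  moreover have "length_weight m f \<kappa> l > 0" for l
    unfolding length_weight_def using assms
    by (intro divide_pos_pos mult_pos_pos prod_pos) auto
  ultimately show ?thesis
    unfolding normalization_def by (intro sum_pos finite_length_vectors) auto
qed

text \<open>The law is consistent: the coordinates of a suitable \<open>pmf\<close> have it.\<close>

lemma filament_lengths_exists:
  assumes "\<And>i. i \<in> {1..f} \<Longrightarrow> \<kappa> i > 0"
  shows "\<exists>p :: (nat \<Rightarrow> nat) pmf. filament_lengths (measure_pmf p) m f \<kappa> (\<lambda>i l. l i)"
proof -
  let ?V = "length_vectors m f"
  define g where "g = (\<lambda>l. if l \<in> ?V then length_weight m f \<kappa> l / normalization m f \<kappa> else 0)"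
  have npos: "normalization m f \<kappa> > 0"
    by (rule normalization_pos) (rule assms)
  have w: "length_weight m f \<kappa> l \<ge> 0" for l
    unfolding length_weight_def using assms
    by (intro divide_nonneg_pos mult_nonneg_nonneg prod_nonneg)
      (auto intro!: less_imp_le)
  have nn: "g l \<ge> 0" for l
    using w npos by (auto simp: g_def less_imp_le)
  have "(\<integral>\<^sup>+ l. ennreal (g l) \<partial>count_space UNIV) = (\<Sum>l\<in>?V. ennreal (g l))"
    by (rule nn_integral_count_space'[OF finite_length_vectors]) (auto simp: g_def)
  also have "\<dots> = ennreal (\<Sum>l\<in>?V. g l)"
    using nn by (intro sum_ennreal) auto
  also have "(\<Sum>l\<in>?V. g l) = 1"
    using npos
    by (auto simp: g_def normalization_def sum_divide_distrib[symmetric])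
  finally have int: "(\<integral>\<^sup>+ l. ennreal (g l) \<partial>count_space UNIV) = 1" by simp
  define p where "p = embed_pmf g"
  have pmf: "pmf p l = g l" for l
    unfolding p_def by (rule pmf_embed_pmf[OF nn int])
  have "measure p {x. \<forall>i\<in>{1..f}. x i = l i} = length_weight m f \<kappa> l / normalization m f \<kappa>"
    if l: "l \<in> ?V" for l
  proof -
    have "measure p {x. \<forall>i\<in>{1..f}. x i = l i} = measure p {l}"
    proof (rule measure_eq_AE)
      show "AE x in p. (x \<in> {x. \<forall>i\<in>{1..f}. x i = l i}) = (x \<in> {l})"
      proof (rule AE_pmfI)
        fix x assume "x \<in> set_pmf p"
        then have "x \<in> ?V" by (auto simp: set_pmf_iff pmf g_def split: if_splits)
        with l show "(x \<in> {x. \<forall>i\<in>{1..f}. x i = l i}) = (x \<in> {l})"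
          unfolding length_vectors_def by (auto intro: PiE_ext)
      qed
    qed auto
    also have "\<dots> = g l" by (simp add: measure_pmf_single pmf)
    finally show ?thesis using l by (simp add: g_def)
  qed
  then have "filament_lengths (measure_pmf p) m f \<kappa> (\<lambda>i l. l i)"
    unfolding filament_lengths_def by (auto simp: measure_pmf.prob_space_axioms)
  then show ?thesis by blast
qed

end

theory Submission
  imports Defs
begin

text \<open>
  Let \<open>X = M / m\<close> and \<open>S = m - M\<close>.  Adding one monomer to filament \<open>j\<close> multiplies the weight of a
  configuration by \<open>M / \<kappa>\<close>, so \<open>\<kappa> E[h(L); L\<^sub>j \<ge> 1] = E[M h(L + e\<^sub>j)]\<close>.  Summing this over \<open>j\<close> with
  \<open>h(l) = l\<^sub>j \<phi>(l)\<close> gives two facts.  For \<open>\<phi> = X - \<psi>\<close> one gets \<open>E[(X - \<psi>) q(X)] \<rightarrow> 0\<close>, where \<open>q\<close> is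
  the limiting quadratic polynomial; its second root is at least \<open>1 + fbar\<close>, hence
  \<open>E[(X - \<psi>)\<^sup>2] \<rightarrow> 0\<close>.  For \<open>\<phi> = 1{l\<^sub>i \<ge> a}\<close> one gets
  \<open>E[S; L\<^sub>i \<ge> a] = E[S + f - 1; L\<^sub>i \<ge> a + 1] + a P[L\<^sub>i = a]\<close>; dividing by \<open>m\<close>, this is in the
  limit \<open>(1 - \<psi>) P[L\<^sub>i \<ge> a] = (1 - \<psi> + fbar) P[L\<^sub>i \<ge> a + 1]\<close>, also when \<open>kbar = 0\<close>.
\<close>

section \<open>Averages over configurations\<close>

abbreviation total_length :: "nat \<Rightarrow> (nat \<Rightarrow> nat) \<Rightarrow> nat" where
  "total_length f l \<equiv> (\<Sum>i=1..f. l i)"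

text \<open>The expectation under the prescribed law as a finite sum, so that all identities and
  estimates are plain algebra; measure theory enters only in
  \<open>filament_lengths_prob\<close>.\<close>

definition length_mean ::
    "nat \<Rightarrow> nat \<Rightarrow> (nat \<Rightarrow> real) \<Rightarrow> ((nat \<Rightarrow> nat) \<Rightarrow> real) \<Rightarrow> real" where
  "length_mean m f \<kappa> h =
     (\<Sum>l\<in>length_vectors m f. length_weight m f \<kappa> l / normalization m f \<kappa> * h l)"

lemma length_weight_pos:
  assumes "\<And>i. i \<in> {1..f} \<Longrightarrow> \<kappa> i > 0"
  shows "length_weight m f \<kappa> l > 0"
  unfolding length_weight_def using assms
  by (intro divide_pos_pos mult_pos_pos prod_pos) auto

lemma length_mean_add:
  "length_mean m f \<kappa> (\<lambda>l. g l + h l) = length_mean m f \<kappa> g + length_mean m f \<kappa> h"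
  by (simp add: length_mean_def distrib_left sum.distrib)

lemma length_mean_diff:
  "length_mean m f \<kappa> (\<lambda>l. g l - h l) = length_mean m f \<kappa> g - length_mean m f \<kappa> h"
  by (simp add: length_mean_def right_diff_distrib sum_subtractf)

lemma length_mean_cmult:
  "length_mean m f \<kappa> (\<lambda>l. c * h l) = c * length_mean m f \<kappa> h"
  by (simp add: length_mean_def sum_distrib_left mult_ac)

lemma length_mean_sum:
  "length_mean m f \<kappa> (\<lambda>l. \<Sum>j\<in>J. h j l) = (\<Sum>j\<in>J. length_mean m f \<kappa> (h j))"
  unfolding length_mean_def sum_distrib_left by (rule sum.swap)

lemma length_mean_cong:
  assumes "\<And>l. l \<in> length_vectors m f \<Longrightarrow> g l = h l"
  shows "length_mean m f \<kappa> g = length_mean m f \<kappa> h"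
  unfolding length_mean_def using assms by (intro sum.cong) auto

lemma length_mean_const:
  assumes "\<And>i. i \<in> {1..f} \<Longrightarrow> \<kappa> i > 0"
  shows "length_mean m f \<kappa> (\<lambda>_. c) = c"
proof -
  have "length_mean m f \<kappa> (\<lambda>_. c) = normalization m f \<kappa> / normalization m f \<kappa> * c"
    unfolding length_mean_def sum_distrib_right[symmetric] sum_divide_distrib[symmetric]
      normalization_def ..
  moreover have "normalization m f \<kappa> > 0"
    by (rule normalization_pos) (rule assms)
  ultimately show ?thesis by simp
qed

lemma length_mean_mono:
  assumes pos: "\<And>i. i \<in> {1..f} \<Longrightarrow> \<kappa> i > 0"
    and le: "\<And>l. l \<in> length_vectors m f \<Longrightarrow> g l \<le> h l"
  shows "length_mean m f \<kappa> g \<le> length_mean m f \<kappa> h"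
proof -
  have "normalization m f \<kappa> > 0"
    by (rule normalization_pos) (rule pos)
  moreover have "length_weight m f \<kappa> l > 0" for l
    by (rule length_weight_pos) (rule pos)
  ultimately show ?thesis
    unfolding length_mean_def using le
    by (intro sum_mono mult_left_mono) (auto simp: less_imp_le)
qed

lemma abs_length_mean_le:
  assumes pos: "\<And>i. i \<in> {1..f} \<Longrightarrow> \<kappa> i > 0"
    and le: "\<And>l. l \<in> length_vectors m f \<Longrightarrow> \<bar>g l\<bar> \<le> h l"
  shows "\<bar>length_mean m f \<kappa> g\<bar> \<le> length_mean m f \<kappa> h"
proof (rule abs_leI)
  show "length_mean m f \<kappa> g \<le> length_mean m f \<kappa> h"
    using le by (intro length_mean_mono pos) force+
  have "length_mean m f \<kappa> (\<lambda>l. - 1 * g l) \<le> length_mean m f \<kappa> h"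
    using le by (intro length_mean_mono pos) force+
  then show "- length_mean m f \<kappa> g \<le> length_mean m f \<kappa> h"
    unfolding length_mean_cmult by simp
qed

text \<open>Nonnegativity of the variance. It later turns the second-moment bound on the monomer
  fraction into a bound on its mean absolute deviation.\<close>

lemma length_mean_square_le:
  assumes pos: "\<And>i. i \<in> {1..f} \<Longrightarrow> \<kappa> i > 0"
  shows "(length_mean m f \<kappa> g)\<^sup>2 \<le> length_mean m f \<kappa> (\<lambda>l. (g l)\<^sup>2)"
proof -
  define \<mu> where "\<mu> = length_mean m f \<kappa> g"
  have const: "length_mean m f \<kappa> (\<lambda>_. c) = c" for c
    by (rule length_mean_const) (rule pos)
  have "0 = length_mean m f \<kappa> (\<lambda>_. 0)"
    by (simp add: length_mean_def)
  also have "\<dots> \<le> length_mean m f \<kappa> (\<lambda>l. (g l - \<mu>)\<^sup>2)"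
    by (intro length_mean_mono pos) auto
  also have "\<dots> = length_mean m f \<kappa> (\<lambda>l. (g l)\<^sup>2 - (2 * \<mu>) * g l + \<mu>\<^sup>2)"
    by (simp add: power2_diff algebra_simps)
  also have "\<dots> = length_mean m f \<kappa> (\<lambda>l. (g l)\<^sup>2) - 2 * \<mu> * \<mu> + \<mu>\<^sup>2"
    by (simp add: length_mean_add length_mean_diff length_mean_cmult const
        flip: \<mu>_def)
  finally show ?thesis
    by (simp add: \<mu>_def power2_eq_square)
qed

section \<open>The shift identity\<close>

lemma total_length_upd:
  assumes "i \<in> {1..f}"
  shows "total_length f (l(i := Suc (l i))) = Suc (total_length f l)"
proof -
  have "total_length f (l(i := Suc (l i))) = Suc (l i) + (\<Sum>j\<in>{1..f}-{i}. (l(i := Suc (l i))) j)"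
    using assms by (subst sum.remove[of _ i]) auto
  also have "(\<Sum>j\<in>{1..f}-{i}. (l(i := Suc (l i))) j) = (\<Sum>j\<in>{1..f}-{i}. l j)"
    by (intro sum.cong) auto
  also have "Suc (l i) + \<dots> = Suc (total_length f l)"
    using assms by (subst (2) sum.remove[of _ i]) auto
  finally show ?thesis .
qed

text \<open>One more monomer contributes a factor \<open>1 / \<kappa> i\<close> and lowers the
  argument of the factorial in the denominator by one. The strict bound on the total length matters:
  at total length \<open>m\<close> truncated subtraction makes the right side zero but the left side
  positive.\<close>

lemma length_weight_upd:
  assumes i: "i \<in> {1..f}" and "\<kappa> i \<noteq> 0" and lt: "total_length f l < m"
  shows "\<kappa> i * length_weight m f \<kappa> (l(i := Suc (l i))) =
    real (m - total_length f l) * length_weight m f \<kappa> l"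
proof -
  define P where "P = (\<Prod>j\<in>{1..f}-{i}. \<kappa> j powi (- int (l j)))"
  have 1: "(\<Prod>j=1..f. \<kappa> j powi (- int (l j))) = \<kappa> i powi (- int (l i)) * P"
    unfolding P_def using i by (intro prod.remove) auto
  have "(\<Prod>j=1..f. \<kappa> j powi (- int ((l(i := Suc (l i))) j))) =
      \<kappa> i powi (- int (Suc (l i))) * (\<Prod>j\<in>{1..f}-{i}. \<kappa> j powi (- int ((l(i := Suc (l i))) j)))"
    using i by (subst prod.remove[of _ i]) auto
  also have "(\<Prod>j\<in>{1..f}-{i}. \<kappa> j powi (- int ((l(i := Suc (l i))) j))) = P"
    unfolding P_def by (intro prod.cong) auto
  finally have 2: "(\<Prod>j=1..f. \<kappa> j powi (- int ((l(i := Suc (l i))) j))) =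
      \<kappa> i powi (- int (Suc (l i))) * P" .
  have 3: "\<kappa> i * \<kappa> i powi (- int (Suc (l i))) = \<kappa> i powi (- int (l i))"
    using \<open>\<kappa> i \<noteq> 0\<close> power_int_add_1'[of "\<kappa> i" "- int (Suc (l i))"] by simp
  obtain d where d: "m - total_length f l = Suc d"
    using lt by (metis Suc_diff_Suc)
  then have d': "m - Suc (total_length f l) = d"
    by simp
  have "\<kappa> i * length_weight m f \<kappa> (l(i := Suc (l i))) =
      fact m * ((\<kappa> i * \<kappa> i powi (- int (Suc (l i)))) * P) / fact d"
    unfolding length_weight_def 2 total_length_upd[OF i] d' by simp
  also have "\<dots> = real (Suc d) * (fact m * (\<kappa> i powi (- int (l i)) * P) / fact (Suc d))"
    unfolding 3 fact_Suc by (simp del: of_nat_Suc)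
  finally show ?thesis
    unfolding length_weight_def 1 d .
qed

text \<open>Adding a monomer to filament \<open>i\<close> is a bijection from the configurations
  with a free monomer (\<open>?A\<close>) onto those with \<open>l i > 0\<close>
  (\<open>?B\<close>), and \<open>length_weight_upd\<close> gives the ratio of the weights.
  Configurations with \<open>l i = 0\<close> drop out on the left because \<open>h\<close> vanishes
  there.\<close>

lemma length_mean_shift:
  assumes i: "i \<in> {1..f}" and nz: "\<kappa> i \<noteq> 0" and h0: "\<And>l. l i = 0 \<Longrightarrow> h l = 0"
  shows "\<kappa> i * length_mean m f \<kappa> h =
    length_mean m f \<kappa> (\<lambda>l. real (m - total_length f l) * h (l(i := Suc (l i))))"
proof -
  let ?w = "\<lambda>l. length_weight m f \<kappa> l / normalization m f \<kappa>"
  let ?up = "\<lambda>l. l(i := Suc (l i))"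
  let ?A = "{l \<in> length_vectors m f. total_length f l < m}"
  let ?B = "{l \<in> length_vectors m f. 0 < l i}"
  have "length_mean m f \<kappa> h = (\<Sum>l\<in>?B. ?w l * h l)"
    unfolding length_mean_def
    by (intro sum.mono_neutral_right finite_length_vectors) (auto simp: h0)
  also have "\<dots> = (\<Sum>l\<in>?A. ?w (?up l) * h (?up l))"
  proof (rule sum.reindex_bij_witness[of _ ?up "\<lambda>l. l(i := l i - 1)"])
    fix l assume l: "l \<in> ?B"
    define k where "k = l(i := l i - 1)"
    have k: "l = ?up k"
      using l by (auto simp: k_def)
    show "?up (l(i := l i - 1)) = l"
      using k by (simp add: k_def)
    then show "?w (?up (l(i := l i - 1))) * h (?up (l(i := l i - 1))) = ?w l * h l"
      by simp
    have "total_length f l = Suc (total_length f k)"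
      by (subst k) (rule total_length_upd[OF i])
    moreover have "k \<in> {1..f} \<rightarrow>\<^sub>E UNIV"
      using l i by (auto simp: k_def length_vectors_def PiE_def extensional_def)
    ultimately have "k \<in> ?A"
      using l by (auto simp: length_vectors_def)
    then show "l(i := l i - 1) \<in> ?A"
      by (simp add: k_def)
  next
    fix l assume l: "l \<in> ?A"
    then have "?up l \<in> {1..f} \<rightarrow>\<^sub>E UNIV"
      using i by (auto simp: length_vectors_def PiE_def extensional_def)
    moreover have "total_length f (?up l) \<le> m"
      using l by (subst total_length_upd[OF i]) simp
    ultimately have "?up l \<in> length_vectors m f"
      unfolding length_vectors_def by blast
    then show "?up l \<in> ?B"
      by simp
  qed auto
  finally have "\<kappa> i * length_mean m f \<kappa> h =
      (\<Sum>l\<in>?A. \<kappa> i * length_weight m f \<kappa> (?up l) / normalization m f \<kappa> * h (?up l))"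
    by (simp add: sum_distrib_left mult_ac)
  also have "\<dots> = (\<Sum>l\<in>?A. ?w l * (real (m - total_length f l) * h (?up l)))"
  proof (intro sum.cong refl)
    fix l assume l: "l \<in> ?A"
    then have "\<kappa> i * length_weight m f \<kappa> (?up l) =
        real (m - total_length f l) * length_weight m f \<kappa> l"
      by (intro length_weight_upd i nz) simp
    then show "\<kappa> i * length_weight m f \<kappa> (?up l) / normalization m f \<kappa> * h (?up l) =
        ?w l * (real (m - total_length f l) * h (?up l))"
      by simp
  qed
  \<comment> \<open>Configurations without a free monomer may be put back into the sum, since the
    factor \<open>m - total_length f l\<close> is zero for them.\<close>
  also have "\<dots> = length_mean m f \<kappa> (\<lambda>l. real (m - total_length f l) * h (?up l))"
    unfolding length_mean_def
    by (intro sum.mono_neutral_left finite_length_vectors)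
      (auto simp: length_vectors_def simp del: of_nat_sum)
  finally show ?thesis .
qed

text \<open>The shift identity for \<open>real (l j) * \<phi> l\<close>, which vanishes at
  \<open>l j = 0\<close>, summed over \<open>j\<close>. The common dissociation constant lets the
  left sides combine into the total length.\<close>

lemma length_mean_total_shift:
  assumes "k > 0"
  shows "k * length_mean m f (\<lambda>_. k) (\<lambda>l. real (total_length f l) * \<phi> l) =
    length_mean m f (\<lambda>_. k) (\<lambda>l. real (m - total_length f l) *
      (\<Sum>j=1..f. real (Suc (l j)) * \<phi> (l(j := Suc (l j)))))"
proof -
  have "k * length_mean m f (\<lambda>_. k) (\<lambda>l. real (total_length f l) * \<phi> l) =
      (\<Sum>j=1..f. k * length_mean m f (\<lambda>_. k) (\<lambda>l. real (l j) * \<phi> l))"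
    by (simp only: of_nat_sum sum_distrib_right length_mean_sum sum_distrib_left)
  also have "\<dots> = (\<Sum>j=1..f. length_mean m f (\<lambda>_. k)
      (\<lambda>l. real (m - total_length f l) * (real (Suc (l j)) * \<phi> (l(j := Suc (l j))))))"
  proof (intro sum.cong refl)
    fix j assume "j \<in> {1..f}"
    from length_mean_shift[OF this, of "\<lambda>_. k" "\<lambda>l. real (l j) * \<phi> l" m] assms
    show "k * length_mean m f (\<lambda>_. k) (\<lambda>l. real (l j) * \<phi> l) = length_mean m f (\<lambda>_. k)
        (\<lambda>l. real (m - total_length f l) * (real (Suc (l j)) * \<phi> (l(j := Suc (l j)))))"
      by simp
  qed
  finally show ?thesis
    by (simp only: length_mean_sum sum_distrib_left)
qed

text \<open>The summed shift identity with the indicator of \<open>a \<le> l i\<close> as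
  \<open>\<phi>\<close> produces terms that are themselves shifts in filament \<open>i\<close>.
  Shifting them back yields the same factor \<open>k\<close> on both sides, so the dissociation
  constant cancels; hence the limit argument also covers \<open>kbar = 0\<close>.\<close>

lemma tail_recursion:
  assumes k: "k > 0" and i: "i \<in> {1..f}"
  shows "length_mean m f (\<lambda>_. k) (\<lambda>l. real (total_length f l) * of_bool (a \<le> l i)) =
    length_mean m f (\<lambda>_. k) (\<lambda>l. (real (total_length f l) + real f - 1) * of_bool (Suc a \<le> l i)) +
    real a * length_mean m f (\<lambda>_. k) (\<lambda>l. of_bool (l i = a))"
proof -
  let ?E = "length_mean m f (\<lambda>_. k)"
  let ?M = "\<lambda>l. real (m - total_length f l)"
  have "(\<Sum>j=1..f. real (Suc (l j)) * of_bool (a \<le> (l(j := Suc (l j))) i)) =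
      (real (total_length f l) + real f) * of_bool (a \<le> l i) + real a * of_bool (Suc (l i) = a)"
    for l :: "nat \<Rightarrow> nat"
  proof -
    \<comment> \<open>Only \<open>j = i\<close> can change the indicator, and only when
      \<open>Suc (l i) = a\<close>; the extra summand then has the weight
      \<open>Suc (l i) = a\<close>.\<close>
    have "(\<Sum>j=1..f. real (Suc (l j)) * of_bool (a \<le> (l(j := Suc (l j))) i)) =
        (\<Sum>j=1..f. real (Suc (l j)) * of_bool (a \<le> l i) +
          (if j = i then real a * of_bool (Suc (l i) = a) else 0))"
      by (intro sum.cong) auto
    also have "\<dots> = (\<Sum>j=1..f. real (Suc (l j)) * of_bool (a \<le> l i)) +
        real a * of_bool (Suc (l i) = a)"
      using i by (simp add: sum.distrib del: of_nat_Suc)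
    also have "(\<Sum>j=1..f. real (Suc (l j)) * of_bool (a \<le> l i)) =
        (real (total_length f l) + real f) * of_bool (a \<le> l i)"
      by (simp add: sum_distrib_right[symmetric] sum.distrib)
    finally show ?thesis .
  qed
  then have "k * ?E (\<lambda>l. real (total_length f l) * of_bool (a \<le> l i)) =
      ?E (\<lambda>l. ?M l * ((real (total_length f l) + real f) * of_bool (a \<le> l i)) +
        real a * (?M l * of_bool (Suc (l i) = a)))"
    by (simp only: length_mean_total_shift[OF k]) (simp add: algebra_simps)
  also have "\<dots> = ?E (\<lambda>l. ?M l * ((real (total_length f l) + real f) * of_bool (a \<le> l i))) +
      real a * ?E (\<lambda>l. ?M l * of_bool (Suc (l i) = a))"
    by (simp only: length_mean_add length_mean_cmult)
  \<comment> \<open>The shift identity read backwards: the total length after the shift is one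
    larger, which explains the \<open>- 1\<close> on the right.\<close>
  also have "?E (\<lambda>l. ?M l * ((real (total_length f l) + real f) * of_bool (a \<le> l i))) =
      k * ?E (\<lambda>l. (real (total_length f l) + real f - 1) * of_bool (Suc a \<le> l i))"
    using k length_mean_shift[OF i, of "\<lambda>_. k"
        "\<lambda>l. (real (total_length f l) + real f - 1) * of_bool (Suc a \<le> l i)" m,
        unfolded total_length_upd[OF i]]
    by (simp add: ac_simps del: of_nat_sum)
  also have "real a * ?E (\<lambda>l. ?M l * of_bool (Suc (l i) = a)) =
      k * (real a * ?E (\<lambda>l. of_bool (l i = a)))"
  \<comment> \<open>For \<open>a = 0\<close> the indicator of \<open>l i = a\<close> does not vanish
    at \<open>l i = 0\<close>, so the shift identity does not apply, but the prefactor
    \<open>a\<close> makes both sides zero.\<close>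
  proof (cases "a = 0")
    case False
    then show ?thesis
      using k length_mean_shift[OF i, of "\<lambda>_. k" "\<lambda>l. of_bool (l i = a)" m] by simp
  qed simp
  finally show ?thesis
    using k by (simp only: distrib_left[symmetric] mult_cancel_left) auto
qed

section \<open>Concentration of the monomer fraction\<close>

abbreviation monomer_fraction :: "nat \<Rightarrow> nat \<Rightarrow> (nat \<Rightarrow> nat) \<Rightarrow> real" where
  "monomer_fraction m f l \<equiv> 1 - real (total_length f l) / real m"

lemma monomer_fraction_bounds:
  assumes "l \<in> length_vectors m f" "m \<ge> 1"
  shows "0 \<le> monomer_fraction m f l" "monomer_fraction m f l \<le> 1"
  using assms by (auto simp: length_vectors_def simp del: of_nat_sum)

text \<open>The summed shift identity for \<open>X - c\<close>, exact for every \<open>m\<close> and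
  every \<open>c\<close>. Each added monomer lowers \<open>X\<close> by \<open>1 / m\<close>, and
  this decrement alone produces the right side.\<close>

lemma quadratic_identity:
  fixes k c :: real and m f :: nat
  assumes k: "k > 0" and m: "m \<ge> 1"
  defines "X \<equiv> monomer_fraction m f"
  shows "length_mean m f (\<lambda>_. k)
      (\<lambda>l. ((X l)\<^sup>2 - X l * (1 + real f / real m + k / real m) + k / real m) * (X l - c)) =
    - length_mean m f (\<lambda>_. k) (\<lambda>l. (1 - X l + real f / real m) * X l) / real m"
proof -
  let ?E = "length_mean m f (\<lambda>_. k)"
  let ?q = "\<lambda>x. x\<^sup>2 - x * (1 + real f / real m + k / real m) + k / real m"
  have m0: "real m > 0"
    using m by simp
  have S: "real (total_length f l) = real m * (1 - X l)" for l
    using m0 by (simp add: X_def)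
  have step: "X (l(j := Suc (l j))) = X l - 1 / real m" if "j \<in> {1..f}" for j l
    unfolding X_def total_length_upd[OF that] by (simp add: add_divide_distrib del: of_nat_sum)
  have sum: "(\<Sum>j=1..f. real (Suc (l j)) * (X (l(j := Suc (l j))) - c)) =
      (real m * (1 - X l) + real f) * (X l - 1 / real m - c)" for l
  proof -
    have "(\<Sum>j=1..f. real (Suc (l j)) * (X (l(j := Suc (l j))) - c)) =
        (\<Sum>j=1..f. real (Suc (l j))) * (X l - 1 / real m - c)"
      unfolding sum_distrib_right by (intro sum.cong) (auto simp: step)
    also have "(\<Sum>j=1..f. real (Suc (l j))) = real m * (1 - X l) + real f"
      unfolding S[symmetric] by (simp add: sum.distrib)
    finally show ?thesis .
  qed
  have "k * ?E (\<lambda>l. real m * (1 - X l) * (X l - c)) =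
      ?E (\<lambda>l. real (m - total_length f l) *
        ((real m * (1 - X l) + real f) * (X l - 1 / real m - c)))"
    using length_mean_total_shift[OF k, of m f "\<lambda>l. X l - c"] unfolding sum S .
  \<comment> \<open>Truncated subtraction agrees with \<open>real m * X l\<close> on admissible
    vectors, which is all that the mean sees.\<close>
  also have "\<dots> = ?E (\<lambda>l. real m * X l * ((real m * (1 - X l) + real f) * (X l - 1 / real m - c)))"
  proof (rule length_mean_cong)
    fix l assume "l \<in> length_vectors m f"
    then have "real (m - total_length f l) = real m * X l"
      using S[of l] by (simp add: length_vectors_def of_nat_diff algebra_simps del: of_nat_sum)
    then show "real (m - total_length f l) *
        ((real m * (1 - X l) + real f) * (X l - 1 / real m - c)) =
        real m * X l * ((real m * (1 - X l) + real f) * (X l - 1 / real m - c))"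
      by simp
  qed
  finally have "0 = ?E (\<lambda>l. k * (real m * (1 - X l) * (X l - c)) -
      real m * X l * ((real m * (1 - X l) + real f) * (X l - 1 / real m - c)))"
    by (simp only: length_mean_diff length_mean_cmult)
  \<comment> \<open>With \<open>F = f / m\<close> and \<open>K = k / m\<close>, the coefficient of
    \<open>X - c\<close> is \<open>K * (1 - X) - X * (1 - X + F)\<close>, which is the quadratic in
    \<open>X\<close>.\<close>
  also have "\<dots> = ?E (\<lambda>l. (real m)\<^sup>2 *
      (?q (X l) * (X l - c) + 1 / real m * ((1 - X l + real f / real m) * X l)))"
    using m0 by (intro length_mean_cong) (simp add: field_simps power2_eq_square)
  also have "\<dots> = (real m)\<^sup>2 * (?E (\<lambda>l. ?q (X l) * (X l - c)) +
      1 / real m * ?E (\<lambda>l. (1 - X l + real f / real m) * X l))"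
    by (simp only: length_mean_add length_mean_cmult)
  finally show ?thesis
    using m0 by (simp add: eq_neg_iff_add_eq_0)
qed

text \<open>The limiting quadratic factors as \<open>- (1 + fbar + kbar - c - x) * (x - c)\<close>,
  and its first factor is at least \<open>fbar\<close> in absolute value on the unit interval. So
  \<open>fbar * (x - c)\<^sup>2\<close> is dominated by minus the quadratic times
  \<open>x - c\<close>; passing to the coefficients for finite \<open>m\<close> costs their
  distances from the limits, and \<open>quadratic_identity\<close> bounds the rest by order
  \<open>1 / m\<close>.\<close>

lemma monomer_fraction_variance:
  assumes k: "k > 0" and m: "m \<ge> 1" and fbar: "fbar \<ge> 0" and c: "0 \<le> c" "c \<le> 1" "c \<le> kbar"
    and root: "c\<^sup>2 - c * (1 + fbar + kbar) + kbar = 0"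
  shows "fbar * length_mean m f (\<lambda>_. k) (\<lambda>l. (monomer_fraction m f l - c)\<^sup>2) \<le>
    (1 + real f / real m) / real m + \<bar>real f / real m - fbar\<bar> + \<bar>k / real m - kbar\<bar>"
proof -
  let ?E = "length_mean m f (\<lambda>_. k)"
  define X where "X = monomer_fraction m f"
  define F where "F = real f / real m"
  define K where "K = k / real m"
  let ?q = "\<lambda>x. x\<^sup>2 - x * (1 + F + K) + K"
  have F0: "F \<ge> 0"
    by (simp add: F_def)
  have X: "0 \<le> X l" "X l \<le> 1" if "l \<in> length_vectors m f" for l
    using monomer_fraction_bounds[OF that m] by (auto simp: X_def)
  have "?E (\<lambda>l. fbar * (X l - c)\<^sup>2) \<le>
      ?E (\<lambda>l. (\<bar>F - fbar\<bar> + \<bar>K - kbar\<bar>) - ?q (X l) * (X l - c))"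
  proof (rule length_mean_mono)
    fix l assume l: "l \<in> length_vectors m f"
    define x where "x = X l"
    have x: "0 \<le> x" "x \<le> 1"
      using X[OF l] by (auto simp: x_def)
    \<comment> \<open>Here \<open>x \<le> 1\<close> and \<open>c \<le> kbar\<close> give
      \<open>1 + fbar + kbar - c - x \<ge> fbar\<close>.\<close>
    have "fbar * (x - c)\<^sup>2 \<le> (1 + fbar + kbar - c - x) * (x - c)\<^sup>2"
      using x c by (intro mult_right_mono) auto
    also have "\<dots> = - (x\<^sup>2 - x * (1 + fbar + kbar) + kbar) * (x - c)"
    proof -
      have "x\<^sup>2 - x * (1 + fbar + kbar) + kbar =
          (x\<^sup>2 - x * (1 + fbar + kbar) + kbar) - (c\<^sup>2 - c * (1 + fbar + kbar) + kbar)"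
        using root by simp
      also have "\<dots> = - ((1 + fbar + kbar - c - x) * (x - c))"
        by (simp add: algebra_simps power2_eq_square)
      finally show ?thesis
        by (simp add: power2_eq_square)
    qed
    \<comment> \<open>The quadratic for finite \<open>m\<close> minus the limiting one is
      \<open>(K - kbar) * (1 - x) - (F - fbar) * x\<close>.\<close>
    also have "\<dots> = ((K - kbar) * (1 - x) - (F - fbar) * x) * (x - c) - ?q x * (x - c)"
      by (simp add: algebra_simps power2_eq_square)
    also have "((K - kbar) * (1 - x) - (F - fbar) * x) * (x - c) \<le> \<bar>F - fbar\<bar> + \<bar>K - kbar\<bar>"
    proof -
      have 1: "\<bar>(K - kbar) * (1 - x)\<bar> \<le> \<bar>K - kbar\<bar>" "\<bar>(F - fbar) * x\<bar> \<le> \<bar>F - fbar\<bar>"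
        using x by (auto simp: abs_mult intro!: mult_left_le)
      have 2: "\<bar>x - c\<bar> \<le> 1"
        using x c by auto
      have "\<bar>((K - kbar) * (1 - x) - (F - fbar) * x) * (x - c)\<bar> \<le>
          \<bar>(K - kbar) * (1 - x) - (F - fbar) * x\<bar>"
        unfolding abs_mult[of _ "x - c"] using 2 by (intro mult_left_le) auto
      then show ?thesis
        using 1 by linarith
    qed
    finally show "fbar * (X l - c)\<^sup>2 \<le> (\<bar>F - fbar\<bar> + \<bar>K - kbar\<bar>) - ?q (X l) * (X l - c)"
      by (simp add: x_def)
  qed (use k in auto)
  also have "\<dots> = \<bar>F - fbar\<bar> + \<bar>K - kbar\<bar> - ?E (\<lambda>l. ?q (X l) * (X l - c))"
    using k by (subst length_mean_diff) (simp add: length_mean_const)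
  also have "?E (\<lambda>l. ?q (X l) * (X l - c)) = - ?E (\<lambda>l. (1 - X l + F) * X l) / real m"
    using quadratic_identity[OF k m, of f c] unfolding X_def F_def K_def .
  finally have upper: "fbar * ?E (\<lambda>l. (X l - c)\<^sup>2) \<le>
      \<bar>F - fbar\<bar> + \<bar>K - kbar\<bar> + ?E (\<lambda>l. (1 - X l + F) * X l) / real m"
    by (simp add: length_mean_cmult)
  have "?E (\<lambda>l. (1 - X l + F) * X l) \<le> ?E (\<lambda>_. 1 + F)"
  proof (rule length_mean_mono)
    fix l assume l: "l \<in> length_vectors m f"
    have "(1 - X l + F) * X l \<le> 1 - X l + F"
      using X[OF l] F0 by (intro mult_left_le) auto
    then show "(1 - X l + F) * X l \<le> 1 + F"
      using X[OF l] by linarith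
  qed (use k in auto)
  also have "\<dots> = 1 + F"
    using k by (simp add: length_mean_const)
  finally have "?E (\<lambda>l. (1 - X l + F) * X l) / real m \<le> (1 + F) / real m"
    by (rule divide_right_mono) simp
  with upper have "fbar * ?E (\<lambda>l. (X l - c)\<^sup>2) \<le> (1 + F) / real m + \<bar>F - fbar\<bar> + \<bar>K - kbar\<bar>"
    by linarith
  then show ?thesis
    unfolding X_def F_def K_def .
qed

section \<open>Transfer to the random variables\<close>

text \<open>The law prescribes only the probabilities of the disjoint events \<open>B l\<close>.
  They sum to one, so an event determined by the lengths of filaments \<open>1\<close> to
  \<open>f\<close> is almost surely a finite union of such events. The hypothesis \<open>dep\<close>
  is there because \<open>L i\<close> is unspecified for other \<open>i\<close>, whereas admissible
  vectors are extensional.\<close>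

lemma filament_lengths_prob:
  assumes law: "filament_lengths \<Omega> m f \<kappa> L" and pos: "\<And>i. i \<in> {1..f} \<Longrightarrow> \<kappa> i > 0"
    and meas: "{\<omega> \<in> space \<Omega>. Q (\<lambda>i. L i \<omega>)} \<in> sets \<Omega>"
    and dep: "\<And>l l'. (\<And>i. i \<in> {1..f} \<Longrightarrow> l i = l' i) \<Longrightarrow> Q l = Q l'"
  shows "measure \<Omega> {\<omega> \<in> space \<Omega>. Q (\<lambda>i. L i \<omega>)} = length_mean m f \<kappa> (\<lambda>l. of_bool (Q l))"
proof -
  let ?V = "length_vectors m f"
  let ?A = "{\<omega> \<in> space \<Omega>. Q (\<lambda>i. L i \<omega>)}"
  define B where "B l = {\<omega> \<in> space \<Omega>. \<forall>i\<in>{1..f}. L i \<omega> = l i}" for l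
  interpret prob_space \<Omega>
    using law by (simp add: filament_lengths_def)
  have [measurable]: "L i \<in> measurable \<Omega> (count_space UNIV)" if "i \<in> {1..f}" for i
    using law that by (simp add: filament_lengths_def)
  have B_sets: "B l \<in> sets \<Omega>" for l
    unfolding B_def by measurable
  have prob_B: "prob (B l) = length_weight m f \<kappa> l / normalization m f \<kappa>" if "l \<in> ?V" for l
    using law that by (simp add: filament_lengths_def B_def)
  have "disjoint_family_on B ?V"
    unfolding disjoint_family_on_def
  proof (intro ballI impI)
    fix l l' assume l: "l \<in> ?V" "l' \<in> ?V" "l \<noteq> l'"
    then have "\<exists>i\<in>{1..f}. l i \<noteq> l' i"
      by (auto simp: length_vectors_def dest: PiE_ext)
    then show "B l \<inter> B l' = {}"
      by (auto simp: B_def)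
  qed
  then have UN: "prob (\<Union>l\<in>W. B l) = (\<Sum>l\<in>W. prob (B l))" if "W \<subseteq> ?V" for W
    using that B_sets finite_length_vectors
    by (intro finite_measure_finite_Union) (auto intro: finite_subset disjoint_family_on_mono)
  have "prob (\<Union>l\<in>?V. B l) = length_mean m f \<kappa> (\<lambda>_. 1)"
    by (simp add: UN prob_B length_mean_def)
  also have "\<dots> = 1"
    by (rule length_mean_const) (rule pos)
  finally have full: "prob (\<Union>l\<in>?V. B l) = 1" .
  have U_sets: "(\<Union>l\<in>W. B l) \<in> sets \<Omega>" if "W \<subseteq> ?V" for W
    using that B_sets finite_length_vectors by (intro sets.finite_UN) (auto intro: finite_subset)
  \<comment> \<open>Hence the total length is at most \<open>m\<close> almost surely; it need not be
    so for every outcome.\<close>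
  have "AE \<omega> in \<Omega>. \<omega> \<in> (\<Union>l\<in>?V. B l)"
    using full U_sets by (intro AE_prob_1) auto
  then have "AE \<omega> in \<Omega>. \<omega> \<in> ?A \<longleftrightarrow> \<omega> \<in> (\<Union>l\<in>{l\<in>?V. Q l}. B l)"
  proof eventually_elim
    fix \<omega> assume "\<omega> \<in> (\<Union>l\<in>?V. B l)"
    then obtain l where l: "l \<in> ?V" "\<omega> \<in> B l"
      by auto
    have Q: "Q (\<lambda>i. L i \<omega>) = Q l'" if "\<omega> \<in> B l'" for l'
      using that by (intro dep) (auto simp: B_def)
    have "\<omega> \<in> space \<Omega>"
      using l by (simp add: B_def)
    with l Q show "\<omega> \<in> ?A \<longleftrightarrow> \<omega> \<in> (\<Union>l\<in>{l\<in>?V. Q l}. B l)"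
      by blast
  qed
  then have "prob ?A = prob (\<Union>l\<in>{l\<in>?V. Q l}. B l)"
    by (intro measure_eq_AE meas U_sets) auto
  also have "\<dots> = (\<Sum>l\<in>{l\<in>?V. Q l}. prob (B l))"
    by (intro UN) auto
  also have "\<dots> = length_mean m f \<kappa> (\<lambda>l. of_bool (Q l))"
    unfolding length_mean_def using finite_length_vectors
    by (intro sum.mono_neutral_cong_left) (auto simp: prob_B)
  finally show ?thesis .
qed

lemma filament_tail_prob:
  assumes law: "filament_lengths \<Omega> m f \<kappa> L" and pos: "\<And>i. i \<in> {1..f} \<Longrightarrow> \<kappa> i > 0"
    and i: "i \<in> {1..f}"
  shows "measure \<Omega> {\<omega> \<in> space \<Omega>. L i \<omega> \<ge> a} = length_mean m f \<kappa> (\<lambda>l. of_bool (a \<le> l i))"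
proof (rule filament_lengths_prob[OF law pos])
  have [measurable]: "L i \<in> measurable \<Omega> (count_space UNIV)"
    using law i by (simp add: filament_lengths_def)
  show "{\<omega> \<in> space \<Omega>. a \<le> L i \<omega>} \<in> sets \<Omega>"
    by measurable
qed (use i in auto)

lemma monomers_prob:
  assumes law: "filament_lengths \<Omega> m f \<kappa> L" and pos: "\<And>i. i \<in> {1..f} \<Longrightarrow> \<kappa> i > 0"
    and m: "m \<ge> 1"
  shows "measure \<Omega> {\<omega> \<in> space \<Omega>. \<bar>monomers m f L \<omega> / real m - c\<bar> > \<epsilon>} =
    length_mean m f \<kappa> (\<lambda>l. of_bool (\<bar>monomer_fraction m f l - c\<bar> > \<epsilon>))"
proof -
  \<comment> \<open>Both sides use real subtraction, so this holds even for outcomes whose total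
    length exceeds \<open>m\<close>.\<close>
  have eq: "monomers m f L \<omega> / real m = monomer_fraction m f (\<lambda>i. L i \<omega>)" for \<omega>
    using m by (simp add: monomers_def diff_divide_distrib)
  show ?thesis
    unfolding eq
  proof (rule filament_lengths_prob[OF law pos])
    have [measurable]: "L i \<in> measurable \<Omega> (count_space UNIV)" if "i \<in> {1..f}" for i
      using law that by (simp add: filament_lengths_def)
    have [measurable]: "(\<lambda>\<omega>. real (L i \<omega>)) \<in> borel_measurable \<Omega>" if "i \<in> {1..f}" for i
      using that by measurable
    have [measurable]: "(\<lambda>\<omega>. \<Sum>i=1..f. real (L i \<omega>)) \<in> borel_measurable \<Omega>"
      by (rule borel_measurable_sum) measurable
    show "{\<omega> \<in> space \<Omega>. \<epsilon> < \<bar>monomer_fraction m f (\<lambda>i. L i \<omega>) - c\<bar>} \<in> sets \<Omega>"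
      unfolding of_nat_sum by measurable
  next
    fix l l' :: "nat \<Rightarrow> nat"
    assume "\<And>i. i \<in> {1..f} \<Longrightarrow> l i = l' i"
    then have "total_length f l = total_length f l'"
      by (intro sum.cong) auto
    then show "(\<epsilon> < \<bar>monomer_fraction m f l - c\<bar>) = (\<epsilon> < \<bar>monomer_fraction m f l' - c\<bar>)"
      by simp
  qed
qed

section \<open>The limit\<close>

text \<open>Existence: the quadratic is \<open>kbar > 0\<close> at \<open>0\<close>, and
  \<open>- kbar * fbar\<close> or \<open>- fbar\<close> at the right end, so it has a zero strictly
  between. Uniqueness: two distinct roots would sum to \<open>1 + fbar + kbar\<close>, but one is
  below \<open>1\<close> and the other below \<open>kbar\<close>.\<close>

lemma limit_root_ex1:
  assumes "fbar > 0" "kbar > 0"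
  shows "\<exists>!x. limit_root fbar kbar x"
proof (rule ex_ex1I)
  let ?q = "\<lambda>x::real. x\<^sup>2 - x * (1 + fbar + kbar) + kbar"
  let ?b = "min kbar 1"
  have qb: "?q ?b < 0"
  proof (cases "kbar \<le> 1")
    case True
    then have "?q ?b = - (kbar * fbar)"
      by (simp add: min_def algebra_simps power2_eq_square)
    then show ?thesis
      using assms by simp
  next
    case False
    then show ?thesis
      using assms by (simp add: min_def)
  qed
  have "\<exists>x\<ge>0. x \<le> ?b \<and> ?q x = 0"
    using assms qb by (intro IVT2') (auto intro!: continuous_intros)
  then obtain x where x: "0 \<le> x" "x \<le> ?b" "?q x = 0"
    by auto
  then have "x \<noteq> 0" "x \<noteq> ?b"
    using assms qb by auto
  then show "\<exists>x. limit_root fbar kbar x"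
    using x by (auto simp: limit_root_def intro!: exI[of _ x])
next
  fix x y assume xy: "limit_root fbar kbar x" "limit_root fbar kbar y"
  then have "(x - y) * (x + y - (1 + fbar + kbar)) = 0"
    by (simp add: limit_root_def algebra_simps power2_eq_square)
  moreover have "x + y < 1 + fbar + kbar"
    using xy assms by (simp add: limit_root_def)
  ultimately show "x = y"
    by simp
qed

text \<open>The non-strict bounds treat both cases of the definition together: for
  \<open>kbar = 0\<close> the value \<open>0\<close> is also a root of the quadratic.\<close>

lemma psi_properties:
  assumes "fbar > 0" "kbar \<ge> 0"
  shows "0 \<le> psi fbar kbar" "psi fbar kbar \<le> 1" "psi fbar kbar \<le> kbar"
    "(psi fbar kbar)\<^sup>2 - psi fbar kbar * (1 + fbar + kbar) + kbar = 0"
proof -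
  have "0 \<le> psi fbar kbar \<and> psi fbar kbar \<le> 1 \<and> psi fbar kbar \<le> kbar \<and>
      (psi fbar kbar)\<^sup>2 - psi fbar kbar * (1 + fbar + kbar) + kbar = 0"
  proof (cases "kbar = 0")
    case False
    then have "limit_root fbar kbar (psi fbar kbar)"
      using theI'[OF limit_root_ex1[of fbar kbar]] assms by (simp add: psi_def)
    then show ?thesis
      by (auto simp: limit_root_def)
  qed (simp add: psi_def)
  then show "0 \<le> psi fbar kbar" "psi fbar kbar \<le> 1" "psi fbar kbar \<le> kbar"
    "(psi fbar kbar)\<^sup>2 - psi fbar kbar * (1 + fbar + kbar) + kbar = 0"
    by auto
qed

text \<open>\<open>tail_recursion\<close> divided by \<open>m\<close>, with the random fraction
  \<open>X\<close> replaced by \<open>c\<close> and \<open>f / m\<close> by \<open>fbar\<close>. The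
  last error term collects the \<open>- 1\<close> and the boundary term
  \<open>a * P[L i = a]\<close>.\<close>

lemma tail_recursion_approx:
  assumes k: "k > 0" and m: "m \<ge> 1" and i: "i \<in> {1..f}"
  shows "\<bar>(fbar + 1 - c) * length_mean m f (\<lambda>_. k) (\<lambda>l. of_bool (Suc a \<le> l i)) -
      (1 - c) * length_mean m f (\<lambda>_. k) (\<lambda>l. of_bool (a \<le> l i))\<bar> \<le>
    2 * length_mean m f (\<lambda>_. k) (\<lambda>l. \<bar>monomer_fraction m f l - c\<bar>) +
    \<bar>real f / real m - fbar\<bar> + (1 + real a) / real m"
proof -
  let ?E = "length_mean m f (\<lambda>_. k)"
  define X where "X = monomer_fraction m f"
  define F where "F = real f / real m"
  have m0: "real m > 0"
    using m by simp
  have S: "real (total_length f l) = real m * (1 - X l)" and f: "real f = real m * F" for l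
    using m0 by (simp_all add: X_def F_def)
  \<comment> \<open>The recursion divided by \<open>m\<close>, all on one side: its mean is zero, so
    it may be added inside the mean before estimating pointwise.\<close>
  let ?g = "\<lambda>l. (1 - X l) * of_bool (a \<le> l i) - (1 - X l + F) * of_bool (Suc a \<le> l i) +
    1 / real m * of_bool (Suc a \<le> l i) - real a / real m * of_bool (l i = a)"
  have "?E ?g = ?E (\<lambda>l. 1 / real m * (real (total_length f l) * of_bool (a \<le> l i) -
      (real (total_length f l) + real f - 1) * of_bool (Suc a \<le> l i) - real a * of_bool (l i = a)))"
    unfolding S f using m0 by (intro length_mean_cong) (simp add: field_simps)
  also have "\<dots> = 0"
    by (simp only: length_mean_cmult length_mean_diff tail_recursion[OF k i]) simp
  finally have eq: "(fbar + 1 - c) * ?E (\<lambda>l. of_bool (Suc a \<le> l i)) - (1 - c) * ?E (\<lambda>l. of_bool (a \<le> l i)) =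
      ?E (\<lambda>l. (fbar + 1 - c) * of_bool (Suc a \<le> l i) - (1 - c) * of_bool (a \<le> l i) + ?g l)"
    by (simp only: length_mean_add[of _ _ _ _ ?g] length_mean_diff[of _ _ _ "\<lambda>l. (fbar + 1 - c) * _ l"]
        length_mean_cmult)
  have "\<bar>?E (\<lambda>l. (fbar + 1 - c) * of_bool (Suc a \<le> l i) - (1 - c) * of_bool (a \<le> l i) + ?g l)\<bar>
      \<le> ?E (\<lambda>l. 2 * \<bar>X l - c\<bar> + (\<bar>F - fbar\<bar> + (1 + real a) / real m))"
  proof (rule abs_length_mean_le)
    fix l
    define p where "p = 1 / real m"
    define q where "q = real a / real m"
    have "p \<ge> 0" "q \<ge> 0" and pq: "(1 + real a) / real m = p + q"
      by (auto simp: p_def q_def add_divide_distrib)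
    \<comment> \<open>In the three cases the integrand equals \<open>fbar - F + p\<close>,
      \<open>c - X l - q\<close> and \<open>0\<close>.\<close>
    moreover have "Suc a \<le> l i \<or> a = l i \<or> l i < a"
      by linarith
    ultimately show "\<bar>(fbar + 1 - c) * of_bool (Suc a \<le> l i) - (1 - c) * of_bool (a \<le> l i) + ?g l\<bar>
        \<le> 2 * \<bar>X l - c\<bar> + (\<bar>F - fbar\<bar> + (1 + real a) / real m)"
      unfolding pq p_def[symmetric] q_def[symmetric]
      by (elim disjE; auto; smt (verit))
  qed (use k in auto)
  also have "\<dots> = 2 * ?E (\<lambda>l. \<bar>X l - c\<bar>) + (\<bar>F - fbar\<bar> + (1 + real a) / real m)"
    unfolding length_mean_add[of _ _ _ "\<lambda>l. 2 * \<bar>X l - c\<bar>"] length_mean_cmult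
    using k by (subst length_mean_const) auto
  finally show ?thesis
    unfolding eq[symmetric] by (simp add: X_def F_def)
qed

theorem corollary1:
  fixes \<Omega> :: "nat \<Rightarrow> 'a measure"
    and f :: "nat \<Rightarrow> nat"
    and \<kappa> :: "nat \<Rightarrow> real"
    and L :: "nat \<Rightarrow> nat \<Rightarrow> 'a \<Rightarrow> nat"
    and fbar kbar :: real
  assumes f_ge_1: "\<And>m. m \<ge> 1 \<Longrightarrow> f m \<ge> 1"
    and kappa_pos: "\<And>m. m \<ge> 1 \<Longrightarrow> \<kappa> m > 0"
    and law: "\<And>m. m \<ge> 1 \<Longrightarrow> filament_lengths (\<Omega> m) m (f m) (\<lambda>_. \<kappa> m) (L m)"
    and f_lim: "(\<lambda>m. real (f m) / real m) \<longlonglongrightarrow> fbar"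
    and kappa_lim: "(\<lambda>m. \<kappa> m / real m) \<longlonglongrightarrow> kbar"
    and fbar_pos: "fbar > 0"
    and kbar_nonneg: "kbar \<ge> 0"
  shows "(kbar > 0 \<longrightarrow> (\<exists>!x. limit_root fbar kbar x)) \<and>
    (\<forall>i\<ge>1. \<forall>l::nat.
       (\<lambda>m. measure (\<Omega> m) {\<omega> \<in> space (\<Omega> m). L m i \<omega> \<ge> l})
         \<longlonglongrightarrow> ((1 - psi fbar kbar) / (fbar + 1 - psi fbar kbar)) ^ l) \<and>
    tendsto_in_probability \<Omega> (\<lambda>m \<omega>. monomers m (f m) (L m) \<omega> / real m) (psi fbar kbar)"
proof (intro conjI allI impI)
  show "\<exists>!x. limit_root fbar kbar x" if "kbar > 0"
    using fbar_pos that by (rule limit_root_ex1)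
next
  define c where "c = psi fbar kbar"
  note c = psi_properties[OF fbar_pos kbar_nonneg, folded c_def]
  define E where "E m = length_mean m (f m) (\<lambda>_. \<kappa> m)" for m
  define X where "X m = monomer_fraction m (f m)" for m
  define V where "V m = E m (\<lambda>l. (X m l - c)\<^sup>2)" for m
  have inv_lim: "(\<lambda>m. b / real m) \<longlonglongrightarrow> 0" for b
    by (rule lim_const_over_n)
  have diff_lim: "(\<lambda>m. real (f m) / real m - fbar) \<longlonglongrightarrow> 0" "(\<lambda>m. \<kappa> m / real m - kbar) \<longlonglongrightarrow> 0"
    using f_lim kappa_lim by (auto simp: LIM_zero_iff)
  have V_nonneg: "V m \<ge> 0" if "m \<ge> 1" for m
    using length_mean_mono[of "f m" "\<lambda>_. \<kappa> m" m "\<lambda>_. 0" "\<lambda>l. (X m l - c)\<^sup>2"] kappa_pos[OF that]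
    by (simp add: V_def E_def length_mean_const)
  have V_lim: "V \<longlonglongrightarrow> 0"
  proof (rule tendsto_sandwich[of "\<lambda>_. 0"])
    \<comment> \<open>The bound of \<open>monomer_fraction_variance\<close> divided by
      \<open>fbar\<close>, its first quotient written as a product to suit the limit rules.\<close>
    let ?r = "\<lambda>m. (((1 + real (f m) / real m) * (1 / real m)) +
      \<bar>real (f m) / real m - fbar\<bar> + \<bar>\<kappa> m / real m - kbar\<bar>) / fbar"
    show "\<forall>\<^sub>F m in sequentially. 0 \<le> V m"
      using V_nonneg by (auto intro: eventually_sequentiallyI)
    show "\<forall>\<^sub>F m in sequentially. V m \<le> ?r m"
    proof (rule eventually_sequentiallyI[of 1])
      fix m :: nat assume m: "m \<ge> 1"
      show "V m \<le> ?r m"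
        using monomer_fraction_variance[OF kappa_pos[OF m] m _ c(1-4), of "f m"] fbar_pos
        by (simp add: V_def E_def X_def pos_le_divide_eq mult.commute)
    qed
    have "?r \<longlonglongrightarrow> (((1 + fbar) * 0) + \<bar>0\<bar> + \<bar>0\<bar>) / fbar"
      using fbar_pos by (intro tendsto_intros f_lim diff_lim inv_lim) auto
    then show "?r \<longlonglongrightarrow> 0"
      by simp
  qed simp
  show "tendsto_in_probability \<Omega> (\<lambda>m \<omega>. monomers m (f m) (L m) \<omega> / real m) (psi fbar kbar)"
    unfolding tendsto_in_probability_def c_def[symmetric]
  proof (intro allI impI)
    fix \<epsilon> :: real assume \<epsilon>: "\<epsilon> > 0"
    show "(\<lambda>m. measure (\<Omega> m) {\<omega> \<in> space (\<Omega> m). \<bar>monomers m (f m) (L m) \<omega> / real m - c\<bar> > \<epsilon>}) \<longlonglongrightarrow> 0"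
    proof (rule tendsto_sandwich[of "\<lambda>_. 0"])
      show "\<forall>\<^sub>F m in sequentially. measure (\<Omega> m)
          {\<omega> \<in> space (\<Omega> m). \<bar>monomers m (f m) (L m) \<omega> / real m - c\<bar> > \<epsilon>} \<le> 1 / \<epsilon>\<^sup>2 * V m"
      proof (rule eventually_sequentiallyI[of 1])
        fix m :: nat assume m: "m \<ge> 1"
        \<comment> \<open>Chebyshev's inequality, centred at \<open>c\<close> rather than at the
          mean.\<close>
        have "E m (\<lambda>l. of_bool (\<bar>X m l - c\<bar> > \<epsilon>)) \<le> E m (\<lambda>l. 1 / \<epsilon>\<^sup>2 * (X m l - c)\<^sup>2)"
          unfolding E_def
        proof (rule length_mean_mono)
          fix l
          have "\<epsilon>\<^sup>2 \<le> (X m l - c)\<^sup>2" if "\<epsilon> < \<bar>X m l - c\<bar>"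
            using that \<epsilon> power_mono[of \<epsilon> "\<bar>X m l - c\<bar>" 2] by simp
          then show "of_bool (\<epsilon> < \<bar>X m l - c\<bar>) \<le> 1 / \<epsilon>\<^sup>2 * (X m l - c)\<^sup>2"
            using \<epsilon> by (simp add: divide_simps)
        qed (use kappa_pos[OF m] in auto)
        also have "\<dots> = 1 / \<epsilon>\<^sup>2 * V m"
          unfolding E_def V_def by (rule length_mean_cmult)
        finally show "measure (\<Omega> m)
            {\<omega> \<in> space (\<Omega> m). \<bar>monomers m (f m) (L m) \<omega> / real m - c\<bar> > \<epsilon>} \<le> 1 / \<epsilon>\<^sup>2 * V m"
          using monomers_prob[OF law[OF m] kappa_pos[OF m] m, of \<epsilon> c] by (simp add: E_def X_def)
      qed
      show "(\<lambda>m. 1 / \<epsilon>\<^sup>2 * V m) \<longlonglongrightarrow> 0"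
        using tendsto_mult[OF tendsto_const[of "1 / \<epsilon>\<^sup>2"] V_lim] by simp
    qed auto
  qed
  fix i a :: nat assume "i \<ge> 1"
  \<comment> \<open>Since \<open>fbar > 0\<close>, the number of filaments tends to infinity, so a
    fixed \<open>i\<close> is eventually the index of a filament.\<close>
  have "filterlim (\<lambda>m. real (f m) / real m * real m) at_top sequentially"
    using f_lim fbar_pos filterlim_real_sequentially by (rule filterlim_tendsto_pos_mult_at_top)
  then have "\<forall>\<^sub>F m in sequentially. real i \<le> real (f m) / real m * real m"
    by (simp add: filterlim_at_top)
  then have ev: "\<forall>\<^sub>F m in sequentially. m \<ge> 1 \<and> i \<in> {1..f m}"
    using eventually_ge_at_top[of 1]
  proof eventually_elim
    case (elim m)
    then show ?case
      using \<open>i \<ge> 1\<close> by simp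
  qed
  define A where "A b m = E m (\<lambda>l. of_bool (b \<le> l i))" for b m
  define D where "D m = E m (\<lambda>l. \<bar>X m l - c\<bar>)" for m
  have D_lim: "D \<longlonglongrightarrow> 0"
  proof (rule tendsto_rabs_zero_cancel, rule tendsto_sandwich[of "\<lambda>_. 0"])
    show "\<forall>\<^sub>F m in sequentially. \<bar>D m\<bar> \<le> sqrt (V m)"
    proof (rule eventually_sequentiallyI[of 1])
      fix m :: nat assume m: "m \<ge> 1"
      have "(D m)\<^sup>2 \<le> V m"
        using length_mean_square_le[of "f m" "\<lambda>_. \<kappa> m" m "\<lambda>l. \<bar>X m l - c\<bar>"] kappa_pos[OF m]
        by (simp add: D_def V_def E_def)
      then show "\<bar>D m\<bar> \<le> sqrt (V m)"
        by (metis real_sqrt_abs real_sqrt_le_iff)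
    qed
    show "(\<lambda>m. sqrt (V m)) \<longlonglongrightarrow> 0"
      using tendsto_real_sqrt[OF V_lim] by simp
  qed auto
  have pos: "fbar + 1 - c > 0"
    using c fbar_pos by simp
  \<comment> \<open>Induction along the approximate recursion, starting from
    \<open>P[L i \<ge> 0] = 1\<close>; each step multiplies the limit by
    \<open>(1 - c) / (fbar + 1 - c)\<close>.\<close>
  have A_lim: "A b \<longlonglongrightarrow> ((1 - c) / (fbar + 1 - c)) ^ b" for b
  proof (induction b)
    case 0
    have "\<forall>\<^sub>F m in sequentially. A 0 m = 1"
      using kappa_pos
      by (intro eventually_sequentiallyI[of 1]) (simp add: A_def E_def length_mean_const)
    then show ?case
      by (simp add: tendsto_eventually)
  next
    case (Suc b)
    have "(\<lambda>m. (fbar + 1 - c) * A (Suc b) m - (1 - c) * A b m) \<longlonglongrightarrow> 0"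
    proof (rule tendsto_rabs_zero_cancel, rule tendsto_sandwich[of "\<lambda>_. 0"])
      let ?r = "\<lambda>m. 2 * D m + \<bar>real (f m) / real m - fbar\<bar> + (1 + real b) / real m"
      show "\<forall>\<^sub>F m in sequentially. \<bar>(fbar + 1 - c) * A (Suc b) m - (1 - c) * A b m\<bar> \<le> ?r m"
        using ev
      proof eventually_elim
        case (elim m)
        then show ?case
          using tail_recursion_approx[OF kappa_pos, of m m i "f m" fbar c b]
          by (simp add: A_def D_def E_def X_def)
      qed
      have "?r \<longlonglongrightarrow> 2 * 0 + \<bar>0\<bar> + 0"
        by (intro tendsto_intros D_lim diff_lim inv_lim)
      then show "?r \<longlonglongrightarrow> 0"
        by simp
    qed auto
    \<comment> \<open>Adding back \<open>(1 - c) * A b m\<close> and dividing by the positive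
      constant \<open>fbar + 1 - c\<close> isolates \<open>A (Suc b) m\<close>.\<close>
    then have "(\<lambda>m. (((fbar + 1 - c) * A (Suc b) m - (1 - c) * A b m) + (1 - c) * A b m) / (fbar + 1 - c))
        \<longlonglongrightarrow> (0 + (1 - c) * ((1 - c) / (fbar + 1 - c)) ^ b) / (fbar + 1 - c)"
      using pos by (intro tendsto_intros Suc.IH) auto
    then show ?case
      using pos by simp
  qed
  have "\<forall>\<^sub>F m in sequentially. A a m = measure (\<Omega> m) {\<omega> \<in> space (\<Omega> m). L m i \<omega> \<ge> a}"
    using ev
  proof eventually_elim
    case (elim m)
    then show ?case
      using filament_tail_prob[OF law, of m i a] kappa_pos[of m] by (simp add: A_def E_def)
  qed
  from tendsto_cong[THEN iffD1, OF this A_lim]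
  show "(\<lambda>m. measure (\<Omega> m) {\<omega> \<in> space (\<Omega> m). L m i \<omega> \<ge> a})
      \<longlonglongrightarrow> ((1 - psi fbar kbar) / (fbar + 1 - psi fbar kbar)) ^ a"
    unfolding c_def .
qed

end
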